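(* Let $(\Lambda_i)_{i\ge 1}$ be a non-negative sequence with $\Lambda_1\ge 1$ such that $(\Lambda_i/i)_{i\ge 1}$ is non-decreasing, and let $(\Gamma_{i,j})_{i,j\ge 1}$ satisfy $$0\le\Gamma_{i,j}=\Gamma_{j,i}\le\Lambda_i\Lambda_j,\qquad i,j\ge 1.$$ Let $(\varphi_{i,j;k})$, $1\le i\le j-1$, $j\ge 2$, $k\ge 1$, be non-negative real numbers satisfying $$\sum_{i=1}^{j-1} i\,\varphi_{i,j;k}=j,\qquad j\ge 2,\ k\ge 1,$$ and, for some constant $\alpha_0\ge 0$, $$\varphi_{i,j;k}\le\alpha_0,\qquad 1\le i\le j-1,\ j\ge 2,\ k\ge 1.$$ Let $\psi^{\mathrm{in}}\in Y_{1,+}$ satisfy $\sum_{i=1}^\infty G_0(i)\psi_i^{\mathrm{in}}<\infty$ for some $G_0\in\mathcal{G}_{1,\infty}$ and $M_\Lambda(\psi^{\mathrm{in}}):=\sum_{i=1}^\infty\Lambda_i\psi_i^{\mathrm{in}}<\infty$. Then there is at least one mass-conserving classical solution $\psi=(\psi_i)_{i\ge 1}$ to the nonlinear breakage system with initial condition $\psi^{\mathrm{in}}$. Furthermore, $\psi$ satisfies $$M_\Lambda(\psi(t)):=\sum_{i=1}^\infty\Lambda_i\psi_i(t)\le M_\Lambda(\psi^{\mathrm{in}}),\qquad t\ge 0.$$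
   Context: All indices are positive integers. Spaces: $Y_1$ is the Banach space of real sequences $\psi=(\psi_i)_{i\ge 1}$ with $\|\psi\|_1:=\sum_{i=1}^\infty i|\psi_i|<\infty$, and $Y_{1,+}:=\{\psi\in Y_1:\psi_i\ge 0 \text{ for each } i\ge 1\}$. The class $\mathcal{G}_{1,\infty}$: $\mathcal{G}_1$ is the set of non-negative convex functions $G\in C^2([0,\infty))$ such that $G(0)=G'(0)=0$ and $G'$ is concave; $\mathcal{G}_{1,\infty}:=\{G\in\mathcal{G}_1:\lim_{\zeta\to\infty}\frac{\zeta G'(\zeta)-G(\zeta)}{\zeta}=\infty\}$. Nonlinear breakage system: $$\frac{d\psi_i}{dt}=\sum_{j=i+1}^\infty\sum_{k=1}^\infty\varphi_{i,j;k}\Gamma_{j,k}\psi_j\psi_k-(1-\delta_{i,1})\sum_{j=1}^\infty\Gamma_{i,j}\psi_i\psi_j,\qquad \psi_i(0)=\psi_i^{\mathrm{in}},\qquad i\ge 1,$$ where $\delta_{1,1}=1$ and $\delta_{i,1}=0$ for $i\ge 2$. Classical solution: a sequence $\psi=(\psi_i)_{i\ge 1}$ of non-negative functions on $[0,\infty)$ with $\psi(t)\in Y_{1,+}$ for all $t\ge 0$ such that, for each $i\ge 1$, $\psi_i\in C^1([0,\infty))$, $$(1-\delta_{i,1})\sum_{j=1}^\infty\Gamma_{i,j}\psi_i\psi_j\in C([0,\infty)),\qquad \sum_{j=i+1}^\infty\sum_{k=1}^\infty\varphi_{i,j;k}\Gamma_{j,k}\psi_j\psi_k\in C([0,\infty)),$$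 and the differential equation (for all $t\ge 0$) and the initial condition of the system are satisfied pointwise for all $i\ge 1$. Mass-conserving means $\|\psi(t)\|_1=\|\psi^{\mathrm{in}}\|_1$ for all $t\ge 0$. *)

theory Defs
  imports "HOL-Analysis.Analysis"
begin

text \<open>
  Sequences indexed by the positive integers are functions on \<^typ>\<open>nat\<close>; their value at \<open>0\<close> is
  irrelevant, since every index below is restricted to be at least \<open>1\<close>. Infinite sums are sums
  over \<open>{1..}\<close> (or \<open>{i+1..}\<close>). As \<^const>\<open>infsum\<close> is \<open>0\<close> on non-summable families, convergence is
  always required separately.
\<close>

definition Y1 :: "(nat \<Rightarrow> real) set" where
  "Y1 = {\<psi>. (\<lambda>i. real i * \<bar>\<psi> i\<bar>) summable_on {1..}}"

definition norm_Y1 :: "(nat \<Rightarrow> real) \<Rightarrow> real" where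
  "norm_Y1 \<psi> = (\<Sum>\<^sub>\<infinity>i\<in>{1..}. real i * \<bar>\<psi> i\<bar>)"

definition Y1_plus :: "(nat \<Rightarrow> real) set" where
  "Y1_plus = {\<psi> \<in> Y1. \<forall>i\<ge>1. \<psi> i \<ge> 0}"

text \<open>
  Derivative of a function on the half-line \<open>[0,\<infinity>)\<close>; at \<open>0\<close> it is the right derivative, so values
  of \<open>f\<close> at negative arguments play no role.
\<close>

definition hderiv :: "(real \<Rightarrow> real) \<Rightarrow> real \<Rightarrow> real" where
  "hderiv f t = vector_derivative f (at t within {0..})"

definition C1_halfline :: "(real \<Rightarrow> real) \<Rightarrow> bool" where
  "C1_halfline f \<longleftrightarrow> f differentiable_on {0..} \<and> continuous_on {0..} (hderiv f)"

definition C2_halfline :: "(real \<Rightarrow> real) \<Rightarrow> bool" where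
  "C2_halfline f \<longleftrightarrow> C1_halfline f \<and> C1_halfline (hderiv f)"

definition G1 :: "(real \<Rightarrow> real) set" where
  "G1 = {G. (\<forall>\<zeta>\<ge>0. G \<zeta> \<ge> 0) \<and> convex_on {0..} G \<and> C2_halfline G
            \<and> G 0 = 0 \<and> hderiv G 0 = 0 \<and> concave_on {0..} (hderiv G)}"

definition G1_inf :: "(real \<Rightarrow> real) set" where
  "G1_inf = {G \<in> G1. filterlim (\<lambda>\<zeta>. (\<zeta> * hderiv G \<zeta> - G \<zeta>) / \<zeta>) at_top at_top}"

text \<open>
  \<open>\<Gamma> i j\<close> is the collision kernel and \<open>\<phi> i j k\<close> stands for \<open>\<phi>\<^sub>i\<^sub>,\<^sub>j\<^sub>;\<^sub>k\<close>, the fragment distribution.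
\<close>

definition gain ::
  "(nat \<Rightarrow> nat \<Rightarrow> nat \<Rightarrow> real) \<Rightarrow> (nat \<Rightarrow> nat \<Rightarrow> real) \<Rightarrow> (nat \<Rightarrow> real) \<Rightarrow> nat \<Rightarrow> real" where
  "gain \<phi> \<Gamma> \<psi> i = (\<Sum>\<^sub>\<infinity>j\<in>{i+1..}. \<Sum>\<^sub>\<infinity>k\<in>{1..}. \<phi> i j k * \<Gamma> j k * \<psi> j * \<psi> k)"

definition gain_converges ::
  "(nat \<Rightarrow> nat \<Rightarrow> nat \<Rightarrow> real) \<Rightarrow> (nat \<Rightarrow> nat \<Rightarrow> real) \<Rightarrow> (nat \<Rightarrow> real) \<Rightarrow> nat \<Rightarrow> bool" where
  "gain_converges \<phi> \<Gamma> \<psi> i \<longleftrightarrow>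
     (\<forall>j\<ge>i+1. (\<lambda>k. \<phi> i j k * \<Gamma> j k * \<psi> j * \<psi> k) summable_on {1..}) \<and>
     (\<lambda>j. \<Sum>\<^sub>\<infinity>k\<in>{1..}. \<phi> i j k * \<Gamma> j k * \<psi> j * \<psi> k) summable_on {i+1..}"

definition loss :: "(nat \<Rightarrow> nat \<Rightarrow> real) \<Rightarrow> (nat \<Rightarrow> real) \<Rightarrow> nat \<Rightarrow> real" where
  "loss \<Gamma> \<psi> i = (1 - of_bool (i = 1)) * (\<Sum>\<^sub>\<infinity>j\<in>{1..}. \<Gamma> i j * \<psi> i * \<psi> j)"

definition loss_converges :: "(nat \<Rightarrow> nat \<Rightarrow> real) \<Rightarrow> (nat \<Rightarrow> real) \<Rightarrow> nat \<Rightarrow> bool" where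
  "loss_converges \<Gamma> \<psi> i \<longleftrightarrow> (\<lambda>j. \<Gamma> i j * \<psi> i * \<psi> j) summable_on {1..}"

text \<open>
  A solution is a function \<open>\<psi>\<close> of the index and the time; \<open>\<lambda>i. \<psi> i t\<close> is the sequence \<open>\<psi>(t)\<close>.
\<close>

definition classical_solution ::
  "(nat \<Rightarrow> nat \<Rightarrow> nat \<Rightarrow> real) \<Rightarrow> (nat \<Rightarrow> nat \<Rightarrow> real) \<Rightarrow> (nat \<Rightarrow> real)
    \<Rightarrow> (nat \<Rightarrow> real \<Rightarrow> real) \<Rightarrow> bool" where
  "classical_solution \<phi> \<Gamma> \<psi>_in \<psi> \<longleftrightarrow>
     (\<forall>t\<ge>0. (\<lambda>i. \<psi> i t) \<in> Y1_plus) \<and>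
     (\<forall>i\<ge>1.
        C1_halfline (\<psi> i) \<and>
        (\<forall>t\<ge>0. loss_converges \<Gamma> (\<lambda>l. \<psi> l t) i) \<and>
        continuous_on {0..} (\<lambda>t. loss \<Gamma> (\<lambda>l. \<psi> l t) i) \<and>
        (\<forall>t\<ge>0. gain_converges \<phi> \<Gamma> (\<lambda>l. \<psi> l t) i) \<and>
        continuous_on {0..} (\<lambda>t. gain \<phi> \<Gamma> (\<lambda>l. \<psi> l t) i) \<and>
        (\<forall>t\<ge>0. hderiv (\<psi> i) t = gain \<phi> \<Gamma> (\<lambda>l. \<psi> l t) i - loss \<Gamma> (\<lambda>l. \<psi> l t) i) \<and>
        \<psi> i 0 = \<psi>_in i)"

definition mass_conserving :: "(nat \<Rightarrow> real) \<Rightarrow> (nat \<Rightarrow> real \<Rightarrow> real) \<Rightarrow> bool" where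
  "mass_conserving \<psi>_in \<psi> \<longleftrightarrow> (\<forall>t\<ge>0. norm_Y1 (\<lambda>i. \<psi> i t) = norm_Y1 \<psi>_in)"

definition M_weight :: "(nat \<Rightarrow> real) \<Rightarrow> (nat \<Rightarrow> real) \<Rightarrow> real" where
  "M_weight \<Lambda> \<psi> = (\<Sum>\<^sub>\<infinity>i\<in>{1..}. \<Lambda> i * \<psi> i)"

definition M_finite :: "(nat \<Rightarrow> real) \<Rightarrow> (nat \<Rightarrow> real) \<Rightarrow> bool" where
  "M_finite \<Lambda> \<psi> \<longleftrightarrow> (\<lambda>i. \<Lambda> i * \<psi> i) summable_on {1..}"

end

theory Submission
  imports Defs
begin

text \<open>
  If \<open>U\<^sub>i / i\<close> is non-decreasing, fragmentation cannot increase \<open>\<Sum>\<^sub>i U\<^sub>i \<psi>\<^sub>i\<close>, because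
  \<open>\<Sum>\<^sub>i i \<phi>\<^sub>i\<^sub>,\<^sub>j\<^sub>;\<^sub>k = j\<close> over \<open>i < j\<close>. With \<open>U\<^sub>i = \<Lambda>\<^sub>i\<close> for \<open>i \<ge> m\<close> and \<open>0\<close> otherwise, each tail of the
  \<open>\<Lambda>\<close>-moment stays below its initial value. The sequences obeying all these tail bounds form a set
  \<open>K\<close> that is compact for pointwise convergence and on which gain, loss and mass are continuous,
  being uniform limits of finite sums. Explicit Euler steps with a small step size, started from
  truncated initial data, remain in \<open>K\<close> and conserve mass exactly, so a limit of the Euler
  approximations is a mass-conserving solution.
\<close>

section \<open>Series over \<open>{p..}\<close> and their tails\<close>

lemma summable_on_atLeast_nonneg:
  fixes f :: "nat \<Rightarrow> real"
  assumes nonneg: "\<And>j. j \<ge> p \<Longrightarrow> 0 \<le> f j" and bound: "\<And>n. (\<Sum>j=p..n. f j) \<le> B"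
  shows "f summable_on {p..}" and "(\<Sum>\<^sub>\<infinity>j\<in>{p..}. f j) \<le> B"
proof -
  have fin: "sum f F \<le> B" if "finite F" "F \<subseteq> {p..}" for F
  proof -
    have "F \<subseteq> {p..Max (insert p F)}"
      using that by auto
    then have "sum f F \<le> (\<Sum>j=p..Max (insert p F). f j)"
      by (intro sum_mono2) (auto intro: nonneg)
    then show ?thesis
      using bound order_trans by blast
  qed
  show s: "f summable_on {p..}"
    by (rule nonneg_bdd_above_summable_on) (auto intro!: nonneg bdd_aboveI2 fin)
  show "(\<Sum>\<^sub>\<infinity>j\<in>{p..}. f j) \<le> B"
    using infsum_le_finite_sums[OF s] fin by blast
qed

lemma infsum_atLeast_split:
  fixes f :: "nat \<Rightarrow> real"
  assumes "f summable_on {p..}"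
  shows "(\<Sum>\<^sub>\<infinity>j\<in>{p..}. f j) = (\<Sum>j=p..<p+n. f j) + (\<Sum>\<^sub>\<infinity>j\<in>{p+n..}. f j)"
proof -
  have "{p..} = {p..<p+n} \<union> {p+n..}"
    by auto
  moreover have "f summable_on {p+n..}"
    using summable_on_subset[OF assms] by simp
  then have "infsum f ({p..<p+n} \<union> {p+n..}) = infsum f {p..<p+n} + infsum f {p+n..}"
    by (intro infsum_Un_disjoint) auto
  ultimately show ?thesis
    by simp
qed

lemma infsum_atLeast_tendsto_0:
  fixes f :: "nat \<Rightarrow> real"
  assumes "f summable_on {p..}"
  shows "(\<lambda>m. \<Sum>\<^sub>\<infinity>j\<in>{m..}. f j) \<longlonglongrightarrow> 0"
proof -
  \<comment> \<open>Setting \<open>f\<close> to 0 below \<open>p\<close> gives a series over all of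
    \<open>nat\<close>; for \<open>m \<ge> p\<close> its tail is the total minus a partial
    sum.\<close>
  have s: "(\<lambda>j. if j < p then 0 else f j) summable_on UNIV"
    using assms by (rule summable_on_cong_neutral[THEN iffD1, rotated -1]) auto
  then have "(\<lambda>m. \<Sum>j<m. if j < p then 0 else f j) \<longlonglongrightarrow> (\<Sum>\<^sub>\<infinity>j\<in>UNIV. if j < p then 0 else f j)"
    using has_sum_imp_sums has_sum_infsum unfolding sums_def by blast
  then have "(\<lambda>m. (\<Sum>\<^sub>\<infinity>j\<in>UNIV. if j < p then 0 else f j) - (\<Sum>j<m. if j < p then 0 else f j)) \<longlonglongrightarrow> 0"
    by (auto intro!: tendsto_eq_intros)
  moreover have "(\<Sum>\<^sub>\<infinity>j\<in>UNIV. if j < p then 0 else f j) - (\<Sum>j<m. if j < p then 0 else f j)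
      = (\<Sum>\<^sub>\<infinity>j\<in>{m..}. f j)" if "m \<ge> p" for m
  proof -
    have "(\<Sum>\<^sub>\<infinity>j\<in>{m..}. if j < p then 0 else f j) = (\<Sum>\<^sub>\<infinity>j\<in>{m..}. f j)"
      using that by (intro infsum_cong) auto
    then show ?thesis
      using infsum_atLeast_split[of "\<lambda>j. if j < p then 0 else f j" 0 m] s
      by (simp add: atLeast0LessThan)
  qed
  then have "\<forall>\<^sub>F m in sequentially. (\<Sum>\<^sub>\<infinity>j\<in>UNIV. if j < p then 0 else f j)
      - (\<Sum>j<m. if j < p then 0 else f j) = (\<Sum>\<^sub>\<infinity>j\<in>{m..}. f j)"
    unfolding eventually_sequentially by blast
  ultimately show ?thesis
    by (rule Lim_transform_eventually)
qed

section \<open>Peano's theorem on a compact set of sequences\<close>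

text \<open>Function types carry the product topology. This is used at two levels: for sequences,
  indexed by \<open>'i\<close>, and for curves of sequences, indexed by time.\<close>

lemma tendsto_fun_iff:
  fixes f :: "'a \<Rightarrow> 'i \<Rightarrow> 'b::topological_space"
  shows "(f \<longlongrightarrow> l) F \<longleftrightarrow> (\<forall>i. ((\<lambda>a. f a i) \<longlongrightarrow> l i) F)"
  using limitin_componentwise[of "\<lambda>_. euclidean" UNIV f l F]
  by (simp add: euclidean_product_topology)

lemma compact_PiE_UNIV:
  fixes S :: "'i \<Rightarrow> 'b::topological_space set"
  assumes "\<And>i. compact (S i)"
  shows "compact (Pi\<^sub>E UNIV S)"
  using assms compactin_PiE[of "\<lambda>_. euclidean" UNIV S]
  by (simp add: euclidean_product_topology)

text \<open>Plays the role of a convergent subsequence, which may fail to exist in an uncountable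
  product such as the space of curves. A cluster point always exists, and the sequence converges to
  it along a suitable finer filter.\<close>

lemma compact_cluster_filter:
  assumes "compact U" and "\<And>n::nat. u n \<in> U"
  obtains x G where "x \<in> U" "G \<noteq> bot" "G \<le> sequentially" "(u \<longlongrightarrow> x) G"
proof -
  have "filtermap u sequentially \<noteq> bot"
    by (simp add: filtermap_bot_iff)
  moreover have "eventually (\<lambda>x. x \<in> U) (filtermap u sequentially)"
    by (simp add: eventually_filtermap assms)
  ultimately obtain x where x: "x \<in> U" and ne: "inf (nhds x) (filtermap u sequentially) \<noteq> bot"
    using \<open>compact U\<close> unfolding compact_filter by blast
  \<comment> \<open>Generated by the preimages under \<open>u\<close> of neighbourhoods of
    \<open>x\<close> and by the tails of \<open>nat\<close>. If a neighbourhood and a tail excluded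
    each other, \<open>u\<close> would eventually avoid that neighbourhood, so \<open>x\<close>
    would not be a cluster point.\<close>
  let ?G = "inf (filtercomap u (nhds x)) sequentially"
  have "?G \<noteq> bot"
  proof
    assume "?G = bot"
    then have "eventually (\<lambda>_. False) ?G"
      by simp
    then obtain P R where P: "eventually P (nhds x)" and R: "eventually R sequentially"
      and PR: "\<And>n. P (u n) \<Longrightarrow> R n \<Longrightarrow> False"
      unfolding eventually_inf eventually_filtercomap by metis
    have "eventually (\<lambda>y. \<not> P y) (filtermap u sequentially)"
      unfolding eventually_filtermap using R by eventually_elim (use PR in blast)
    then have "eventually (\<lambda>_. False) (inf (nhds x) (filtermap u sequentially))"
      unfolding eventually_inf using P by blast
    with ne show False
      by (simp add: trivial_limit_def)
  qed
  moreover have "(u \<longlongrightarrow> x) ?G"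
    by (simp add: filterlim_def filtermap_le_iff_le_filtercomap)
  ultimately show ?thesis
    using that x by simp
qed

text \<open>A discrete mean value inequality: each increment \<open>h * v l\<close> differs from
  \<open>h * c\<close> by at most \<open>h * e\<close>, and the errors add up.\<close>

lemma telescope_abs_le:
  fixes y v :: "nat \<Rightarrow> real"
  assumes step: "\<And>l. y (Suc l) = y l + h * v l" and "0 \<le> h" and "a \<le> b"
    and close: "\<And>l. a \<le> l \<Longrightarrow> l < b \<Longrightarrow> \<bar>v l - c\<bar> \<le> e"
  shows "\<bar>y b - y a - (real b * h - real a * h) * c\<bar> \<le> e * (real b * h - real a * h)"
  using \<open>a \<le> b\<close> close
proof (induction b rule: dec_induct)
  case (step l)
  have "\<bar>h * (v l - c)\<bar> \<le> h * e"
    unfolding abs_mult using step \<open>0 \<le> h\<close> by (simp add: mult_left_mono)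
  moreover have "\<bar>y l - y a - (real l * h - real a * h) * c\<bar> \<le> e * (real l * h - real a * h)"
    using step by simp
  ultimately show ?case
    unfolding assms(1) by (simp add: algebra_simps)
qed simp

text \<open>Peano's theorem on a compact set that is left invariant by explicit Euler steps. The limit is
  taken along a filter finer than \<^const>\<open>sequentially\<close>, which Tychonoff's theorem provides
  directly; no diagonal sequence is extracted.\<close>

lemma euler_limit:
  fixes K :: "('i \<Rightarrow> real) set" and F :: "'i \<Rightarrow> ('i \<Rightarrow> real) \<Rightarrow> real"
    and X :: "nat \<Rightarrow> nat \<Rightarrow> 'i \<Rightarrow> real" and h :: "nat \<Rightarrow> real"
  assumes K: "compact K" and cont: "\<And>i. continuous_on K (F i)"
    and XK: "\<And>n m. X n m \<in> K"
    and step: "\<And>n m i. X n (Suc m) i = X n m i + h n * F i (X n m)"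
    and h_pos: "\<And>n. 0 < h n" and h_null: "h \<longlonglongrightarrow> 0"
    and init: "(\<lambda>n. X n 0) \<longlonglongrightarrow> x0"
  obtains f :: "real \<Rightarrow> 'i \<Rightarrow> real" where "\<And>t. f t \<in> K" "f 0 = x0"
    "\<And>i t. t \<ge> 0 \<Longrightarrow> ((\<lambda>s. f s i) has_real_derivative F i (f t)) (at t within {0..})"
    "\<And>(H :: ('i \<Rightarrow> real) \<Rightarrow> real) t. continuous_on K H \<Longrightarrow> (\<And>n m. H (X n m) = H (X n 0))
       \<Longrightarrow> H (f t) = H x0"
proof -
  \<comment> \<open>For \<open>t \<ge> 0\<close>, \<open>g n t\<close> is the last grid point not
    after \<open>t\<close> and \<open>a n t\<close> its index; \<open>\<gamma> n\<close> is the
    piecewise constant Euler curve. For negative \<open>t\<close> the conversion \<open>nat\<close>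
    gives index 0, so \<open>\<gamma> n t\<close> lies in \<open>K\<close> for every real
    \<open>t\<close>.\<close>
  define a where "a n t = nat \<lfloor>t / h n\<rfloor>" for n t
  define \<gamma> where "\<gamma> n t = X n (a n t)" for n t
  define g where "g n t = real (a n t) * h n" for n t
  \<comment> \<open>Compactness over all times at once gives a limit curve that is so far only
    pointwise; its regularity is derived afterwards.\<close>
  have "compact (Pi\<^sub>E UNIV (\<lambda>_::real. K))"
    by (intro compact_PiE_UNIV K)
  moreover have "\<gamma> n \<in> Pi\<^sub>E UNIV (\<lambda>_::real. K)" for n
    by (auto simp: \<gamma>_def XK)
  ultimately obtain f G where f: "f \<in> Pi\<^sub>E UNIV (\<lambda>_::real. K)" and G: "G \<noteq> bot" "G \<le> sequentially"
    and lim: "(\<gamma> \<longlongrightarrow> f) G"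
    by (rule compact_cluster_filter)
  have fK: "f t \<in> K" for t
    using f by auto
  have lim_t: "((\<lambda>n. \<gamma> n t) \<longlongrightarrow> f t) G" for t
    using lim by (simp add: tendsto_fun_iff)
  have lim_ti: "((\<lambda>n. \<gamma> n t i) \<longlongrightarrow> f t i) G" for t i
    using lim_t by (simp add: tendsto_fun_iff)
  have h_G: "(h \<longlongrightarrow> 0) G"
    using h_null G(2) by (rule tendsto_mono[rotated])
  have g_le: "g n t \<le> t" and g_gt: "t - h n < g n t" if "t \<ge> 0" for n t
  proof -
    have r: "real (a n t) = of_int \<lfloor>t / h n\<rfloor>"
      using that h_pos[of n] by (simp add: a_def)
    show "g n t \<le> t"
      using floor_divide_lower[OF h_pos[of n], of t] by (simp add: g_def r)
    show "t - h n < g n t"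
      using floor_divide_upper[OF h_pos[of n], of t] by (simp add: g_def r algebra_simps)
  qed
  have g_lim: "((\<lambda>n. g n t) \<longlongrightarrow> t) G" if "t \<ge> 0" for t
  proof (rule tendsto_sandwich)
    show "((\<lambda>n. t - h n) \<longlongrightarrow> t) G"
      using h_G by (auto intro!: tendsto_eq_intros)
  qed (auto simp: g_le less_imp_le[OF g_gt] that)
  have a_mono: "a n s \<le> a n t" if "s \<le> t" for n s t
    unfolding a_def using that h_pos[of n] by (intro nat_mono floor_mono divide_right_mono) auto
  have grid: "\<gamma> n (real l * h n) = X n l" for n l
    using h_pos[of n] by (simp add: \<gamma>_def a_def)

  \<comment> \<open>The window for \<open>u\<close> starts \<open>h n\<close> before the earlier
    time, because the grid point belonging to that time may precede it by almost a full
    step.\<close>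
  have mean_value: "\<bar>\<gamma> n s i - \<gamma> n t i - (g n s - g n t) * c\<bar> \<le> e * \<bar>g n s - g n t\<bar>"
    if st: "s \<ge> 0" "t \<ge> 0" and close: "\<And>u. u \<ge> 0 \<Longrightarrow> min s t - h n < u \<Longrightarrow> u \<le> max s t
      \<Longrightarrow> \<bar>F i (\<gamma> n u) - c\<bar> \<le> e" for n s t i c e
  proof -
    have *: "\<bar>\<gamma> n s i - \<gamma> n t i - (g n s - g n t) * c\<bar> \<le> e * (g n s - g n t)"
      if st: "0 \<le> t" "t \<le> s" and close: "\<And>u. u \<ge> 0 \<Longrightarrow> t - h n < u \<Longrightarrow> u \<le> s
      \<Longrightarrow> \<bar>F i (\<gamma> n u) - c\<bar> \<le> e" for s t
      unfolding \<gamma>_def g_def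
    proof (rule telescope_abs_le[where v = "\<lambda>l. F i (X n l)"])
      fix l assume l: "a n t \<le> l" "l < a n s"
      have "g n t \<le> real l * h n" "real l * h n \<le> g n s"
        unfolding g_def using l h_pos[of n] by auto
      then show "\<bar>F i (X n l) - c\<bar> \<le> e"
        using close[of "real l * h n"] g_gt[of t n] g_le[of s n] st h_pos[of n]
        by (simp add: grid)
    qed (use st h_pos[of n] in \<open>auto simp: step a_mono\<close>)
    have g_mono: "g n s \<le> g n t" if "s \<le> t" for s t
      unfolding g_def using a_mono[OF that, of n] h_pos[of n] by simp
    show ?thesis
    proof (cases "t \<le> s")
      case True
      then show ?thesis
        using *[of t s] g_mono[of t s] st close by auto
    next
      case False
      then have "\<bar>\<gamma> n t i - \<gamma> n s i - (g n t - g n s) * c\<bar> \<le> e * (g n t - g n s)"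
        using *[of s t] st close by auto
      moreover have "\<gamma> n s i - \<gamma> n t i - (g n s - g n t) * c
          = - (\<gamma> n t i - \<gamma> n s i - (g n t - g n s) * c)"
        by (simp add: algebra_simps)
      ultimately show ?thesis
        using False g_mono[of s t] by (simp add: abs_minus_commute)
    qed
  qed

  \<comment> \<open>Upgrades pointwise convergence to joint convergence in \<open>n\<close> and
    time. \<open>F i\<close> is bounded on the compact set \<open>K\<close>, so
    \<open>mean_value\<close> with \<open>c = 0\<close> makes the Euler curves Lipschitz up to an
    error of order \<open>h n\<close>. The time filter is built from \<open>nhds t\<close>, so it
    does not exclude \<open>t\<close> itself.\<close>
  have joint: "((\<lambda>p. \<gamma> (fst p) (snd p)) \<longlongrightarrow> f t) (G \<times>\<^sub>F inf (nhds t) (principal {0..}))"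
    if "t \<ge> 0" for t
    unfolding tendsto_fun_iff
  proof
    fix i
    let ?N = "G \<times>\<^sub>F inf (nhds t) (principal {0..})"
    obtain C where C: "0 < C" "\<And>x. x \<in> K \<Longrightarrow> \<bar>F i x\<bar> \<le> C"
      using compact_imp_bounded[OF compact_continuous_image[OF cont K], of i]
      unfolding bounded_pos by auto
    have fst_G: "filterlim fst G ?N"
      by (rule filterlim_fst)
    have "filterlim snd (inf (nhds t) (principal {0..})) ?N"
      by (rule filterlim_snd)
    then have snd_t: "(snd \<longlongrightarrow> t) ?N" and snd_0: "\<forall>\<^sub>F p in ?N. snd p \<ge> 0"
      by (auto simp: filterlim_inf filterlim_principal)
    have "((\<lambda>p. C * (\<bar>snd p - t\<bar> + h (fst p))) \<longlongrightarrow> C * (\<bar>t - t\<bar> + 0)) ?N"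
      by (intro tendsto_intros snd_t filterlim_compose[OF h_G fst_G])
    then have "((\<lambda>p. C * (\<bar>snd p - t\<bar> + h (fst p))) \<longlongrightarrow> 0) ?N"
      by simp
    moreover have "\<forall>\<^sub>F p in ?N. norm (\<gamma> (fst p) (snd p) i - \<gamma> (fst p) t i)
        \<le> C * (\<bar>snd p - t\<bar> + h (fst p))"
      using snd_0
    proof eventually_elim
      case (elim p)
      obtain n s where p: "p = (n, s)"
        by fastforce
      have "\<bar>\<gamma> n s i - \<gamma> n t i\<bar> \<le> C * \<bar>g n s - g n t\<bar>"
        using mean_value[of s t n i 0 C] elim p that C(2) XK by (simp add: \<gamma>_def)
      also have "\<dots> \<le> C * (\<bar>s - t\<bar> + h n)"
        using g_le[of s n] g_le[of t n] g_gt[of s n] g_gt[of t n] elim p that C(1)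
        by (intro mult_left_mono) auto
      finally show ?case
        by (simp add: p)
    qed
    ultimately have "((\<lambda>p. \<gamma> (fst p) (snd p) i - \<gamma> (fst p) t i) \<longlongrightarrow> 0) ?N"
      by (rule Lim_null_comparison[rotated])
    then have "((\<lambda>p. (\<gamma> (fst p) (snd p) i - \<gamma> (fst p) t i) + \<gamma> (fst p) t i) \<longlongrightarrow> 0 + f t i) ?N"
      by (intro tendsto_intros filterlim_compose[OF lim_ti fst_G])
    then show "((\<lambda>p. \<gamma> (fst p) (snd p) i) \<longlongrightarrow> f t i) ?N"
      by simp
  qed

  \<comment> \<open>By joint convergence and continuity of \<open>F i\<close>, the Euler slopes near
    time \<open>t\<close> are within \<open>e\<close> of \<open>F i (f t)\<close>. Then
    \<open>mean_value\<close> with this constant as \<open>c\<close> passes to the limit as the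
    difference quotient estimate.\<close>
  have deriv: "((\<lambda>s. f s i) has_real_derivative F i (f t)) (at t within {0..})"
    if t: "t \<ge> 0" for i t
    unfolding has_field_derivative_def has_derivative_within_alt
  proof (intro conjI allI impI bounded_linear_mult_right)
    fix e :: real assume e: "e > 0"
    have "((\<lambda>p. F i (\<gamma> (fst p) (snd p))) \<longlongrightarrow> F i (f t)) (G \<times>\<^sub>F inf (nhds t) (principal {0..}))"
      using joint[OF t] fK XK
      by (intro continuous_on_tendsto_compose[OF cont]) (auto simp: \<gamma>_def)
    then have "\<forall>\<^sub>F p in G \<times>\<^sub>F inf (nhds t) (principal {0..}).
        dist (F i (\<gamma> (fst p) (snd p))) (F i (f t)) < e"
      using e by (rule tendstoD)
    then obtain P R where P: "eventually P G" and R: "eventually R (inf (nhds t) (principal {0..}))"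
      and PR: "\<And>n s. P n \<Longrightarrow> R s \<Longrightarrow> \<bar>F i (\<gamma> n s) - F i (f t)\<bar> < e"
      unfolding eventually_prod_filter by (auto simp: dist_real_def)
    obtain d where d: "d > 0" "\<And>s. s \<ge> 0 \<Longrightarrow> \<bar>s - t\<bar> < d \<Longrightarrow> R s"
      using R unfolding eventually_inf_principal eventually_nhds_metric by (auto simp: dist_real_def)
    show "\<exists>d>0. \<forall>s\<in>{0..}. norm (s - t) < d \<longrightarrow>
        norm (f s i - f t i - F i (f t) * (s - t)) \<le> e * norm (s - t)"
    \<comment> \<open>Half of \<open>d\<close> bounds the distance from \<open>s\<close> to
      \<open>t\<close>; the other half absorbs the extra \<open>h n\<close> in the window of
      \<open>mean_value\<close>.\<close>
    proof (intro exI[of _ "d / 2"] conjI ballI impI)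
      fix s assume s: "s \<in> {0::real..}" "norm (s - t) < d / 2"
      have "\<forall>\<^sub>F n in G. h n < d / 2"
        using order_tendstoD(2)[OF h_G, of "d / 2"] d(1) by simp
      with P have "\<forall>\<^sub>F n in G. \<bar>\<gamma> n s i - \<gamma> n t i - (g n s - g n t) * F i (f t)\<bar>
          \<le> e * \<bar>g n s - g n t\<bar>"
      proof eventually_elim
        case (elim n)
        show ?case
        proof (rule mean_value)
          fix u assume u: "u \<ge> 0" "min s t - h n < u" "u \<le> max s t"
          then have "\<bar>u - t\<bar> < d"
            using elim s by (auto simp: min_def max_def abs_if split: if_splits)
          then show "\<bar>F i (\<gamma> n u) - F i (f t)\<bar> \<le> e"
            using PR elim d(2) u by (intro less_imp_le) auto
        qed (use s t in auto)
      qed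
      moreover have "((\<lambda>n. \<bar>\<gamma> n s i - \<gamma> n t i - (g n s - g n t) * F i (f t)\<bar>)
          \<longlongrightarrow> \<bar>f s i - f t i - (s - t) * F i (f t)\<bar>) G"
        using s t by (intro tendsto_intros lim_ti g_lim) auto
      moreover have "((\<lambda>n. e * \<bar>g n s - g n t\<bar>) \<longlongrightarrow> e * \<bar>s - t\<bar>) G"
        using s t by (intro tendsto_intros g_lim) auto
      ultimately have "\<bar>f s i - f t i - (s - t) * F i (f t)\<bar> \<le> e * \<bar>s - t\<bar>"
        using tendsto_le[OF G(1)] by blast
      then show "norm (f s i - f t i - F i (f t) * (s - t)) \<le> e * norm (s - t)"
        by (simp add: mult.commute)
    qed (use d in auto)
  qed

  have init_G: "((\<lambda>n. X n 0) \<longlongrightarrow> x0) G"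
    using init G(2) by (rule tendsto_mono[rotated])
  have f0: "f 0 = x0"
  proof
    fix i
    have "((\<lambda>n. X n 0 i) \<longlongrightarrow> x0 i) G"
      using init_G by (simp add: tendsto_fun_iff)
    then show "f 0 i = x0 i"
      using tendsto_unique[OF G(1) lim_ti[of 0 i]] by (simp add: \<gamma>_def a_def)
  qed
  \<comment> \<open>Both \<open>f t\<close> and \<open>x0\<close> are limits along \<open>G\<close>
    of points of \<open>K\<close>, and \<open>H\<close> takes equal values on the two approximating
    families.\<close>
  moreover have "H (f t) = H x0"
    if H: "continuous_on K H" "\<And>n m. H (X n m) = H (X n 0)" for H :: "('i \<Rightarrow> real) \<Rightarrow> real" and t
  proof (rule tendsto_unique[OF G(1)])
    have "((\<lambda>n. H (\<gamma> n t)) \<longlongrightarrow> H (f t)) G"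
      using fK XK by (intro continuous_on_tendsto_compose[OF H(1) lim_t]) (auto simp: \<gamma>_def)
    then show "((\<lambda>n. H (X n 0)) \<longlongrightarrow> H (f t)) G"
      by (subst (asm) \<gamma>_def, subst (asm) H(2))
    show "((\<lambda>n. H (X n 0)) \<longlongrightarrow> H x0) G"
      using fK[of 0] XK f0 by (intro continuous_on_tendsto_compose[OF H(1) init_G]) auto
  qed
  ultimately show ?thesis
    using that fK deriv by blast
qed

section \<open>Sequences with prescribed moment tails\<close>

locale tail_bound =
  fixes \<Lambda> T :: "nat \<Rightarrow> real"
  assumes weight_ge: "i \<ge> 1 \<Longrightarrow> real i \<le> \<Lambda> i" and tail_null: "T \<longlonglongrightarrow> 0"
begin

lemma weight_nonneg: "i \<ge> 1 \<Longrightarrow> 0 \<le> \<Lambda> i"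
  using weight_ge[of i] by simp

text \<open>Tail bounds are imposed on finite partial sums, so each is a closed condition on
  finitely many coordinates and no summability has to be demanded. Coordinate 0 is not reached by
  these bounds and is therefore fixed.\<close>

definition K :: "(nat \<Rightarrow> real) set" where
  "K = {x. x 0 = 0 \<and> (\<forall>i. 0 \<le> x i) \<and> (\<forall>m\<ge>1. \<forall>n. (\<Sum>i=m..n. \<Lambda> i * x i) \<le> T m)}"

lemma K_nonneg: "x \<in> K \<Longrightarrow> 0 \<le> x i"
  by (simp add: K_def)

lemma K_sum_le: "x \<in> K \<Longrightarrow> m \<ge> 1 \<Longrightarrow> (\<Sum>i=m..n. \<Lambda> i * x i) \<le> T m"
  by (simp add: K_def)

lemma K_tail_nonneg: "x \<in> K \<Longrightarrow> m \<ge> 1 \<Longrightarrow> 0 \<le> T m"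
  using K_sum_le[of x m 0] by simp

lemma K_weighted_le: "x \<in> K \<Longrightarrow> i \<ge> 1 \<Longrightarrow> \<Lambda> i * x i \<le> T 1"
proof -
  assume x: "x \<in> K" and "i \<ge> 1"
  then have "\<Lambda> i * x i \<le> (\<Sum>j=1..i. \<Lambda> j * x j)"
    by (intro member_le_sum) (auto simp: weight_nonneg K_nonneg)
  then show ?thesis
    using K_sum_le[OF x, of 1 i] by simp
qed

context
  fixes w :: "nat \<Rightarrow> real" and c :: real and p :: nat and x :: "nat \<Rightarrow> real"
  assumes x: "x \<in> K" and p: "p \<ge> 1" and c: "0 \<le> c"
    and w: "\<And>j. j \<ge> p \<Longrightarrow> \<bar>w j\<bar> \<le> c * \<Lambda> j"
begin

lemma weighted_sum_abs_le: "(\<Sum>j=p..n. \<bar>w j * x j\<bar>) \<le> c * T p"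
proof -
  have "(\<Sum>j=p..n. \<bar>w j * x j\<bar>) \<le> (\<Sum>j=p..n. c * (\<Lambda> j * x j))"
  proof (intro sum_mono)
    fix j assume "j \<in> {p..n}"
    then have "\<bar>w j\<bar> * x j \<le> c * \<Lambda> j * x j"
      by (intro mult_right_mono w K_nonneg x) auto
    then show "\<bar>w j * x j\<bar> \<le> c * (\<Lambda> j * x j)"
      by (simp add: abs_mult K_nonneg x mult.assoc)
  qed
  also have "\<dots> \<le> c * T p"
    using K_sum_le[OF x p, of n] c by (simp add: sum_distrib_left[symmetric] mult_left_mono)
  finally show ?thesis .
qed

lemma weighted_abs_summable: "(\<lambda>j. norm (w j * x j)) summable_on {p..}"
  using weighted_sum_abs_le by (intro summable_on_atLeast_nonneg(1)) auto

lemma weighted_summable: "(\<lambda>j. w j * x j) summable_on {p..}"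
  using weighted_abs_summable by (rule abs_summable_summable)

lemma weighted_infsum_le: "\<bar>\<Sum>\<^sub>\<infinity>j\<in>{p..}. w j * x j\<bar> \<le> c * T p"
proof -
  have "\<bar>\<Sum>\<^sub>\<infinity>j\<in>{p..}. w j * x j\<bar> \<le> (\<Sum>\<^sub>\<infinity>j\<in>{p..}. \<bar>w j * x j\<bar>)"
    using norm_infsum_bound[OF weighted_abs_summable] by simp
  also have "\<dots> \<le> c * T p"
    using weighted_sum_abs_le by (intro summable_on_atLeast_nonneg(2)) auto
  finally show ?thesis .
qed

end

text \<open>On \<open>K\<close> the remainder after \<open>n\<close> terms is at most
  \<open>c * T (p + n)\<close>, uniformly in \<open>x\<close>, so the series is a uniform limit of
  continuous finite sums. The weights may depend on \<open>x\<close>, which accommodates nested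
  series.\<close>

lemma continuous_on_weighted_infsum:
  assumes p: "p \<ge> 1" and c: "0 \<le> c"
    and w: "\<And>x j. x \<in> K \<Longrightarrow> j \<ge> p \<Longrightarrow> \<bar>w x j\<bar> \<le> c * \<Lambda> j"
    and cont: "\<And>j. j \<ge> p \<Longrightarrow> continuous_on K (\<lambda>x. w x j)"
  shows "continuous_on K (\<lambda>x. \<Sum>\<^sub>\<infinity>j\<in>{p..}. w x j * x j)"
proof (rule uniform_limit_theorem)
  show "\<forall>\<^sub>F n in sequentially. continuous_on K (\<lambda>x. \<Sum>j=p..<p+n. w x j * x j)"
    by (intro always_eventually allI continuous_on_sum continuous_on_mult cont
        continuous_on_subset[OF continuous_on_product_coordinates]) auto
  show "uniform_limit K (\<lambda>n x. \<Sum>j=p..<p+n. w x j * x j) (\<lambda>x. \<Sum>\<^sub>\<infinity>j\<in>{p..}. w x j * x j) sequentially"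
  proof (rule uniform_limitI)
    fix e :: real assume "e > 0"
    have "(\<lambda>n. c * T (n + p)) \<longlonglongrightarrow> c * 0"
      by (intro tendsto_intros LIMSEQ_ignore_initial_segment tail_null)
    then have "\<forall>\<^sub>F n in sequentially. c * T (n + p) < e"
      using \<open>e > 0\<close> by (simp add: order_tendstoD)
    then show "\<forall>\<^sub>F n in sequentially. \<forall>x\<in>K. dist (\<Sum>j=p..<p+n. w x j * x j)
        (\<Sum>\<^sub>\<infinity>j\<in>{p..}. w x j * x j) < e"
    proof eventually_elim
      case (elim n)
      show ?case
      proof
        fix x assume x: "x \<in> K"
        have "(\<lambda>j. w x j * x j) summable_on {p..}"
          using weighted_summable[OF x p c w[OF x]] by simp
        then have "dist (\<Sum>j=p..<p+n. w x j * x j) (\<Sum>\<^sub>\<infinity>j\<in>{p..}. w x j * x j)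
            = \<bar>\<Sum>\<^sub>\<infinity>j\<in>{p+n..}. w x j * x j\<bar>"
          using infsum_atLeast_split[of "\<lambda>j. w x j * x j" p n] by (simp add: dist_real_def)
        also have "\<dots> \<le> c * T (p + n)"
          using weighted_infsum_le[OF x _ c w[OF x], of "p + n"] p by simp
        finally show "dist (\<Sum>j=p..<p+n. w x j * x j) (\<Sum>\<^sub>\<infinity>j\<in>{p..}. w x j * x j) < e"
          using elim by (simp add: add.commute)
      qed
    qed
  qed
qed simp

text \<open>\<open>K\<close> is closed, and \<open>weight_ge\<close> gives
  \<open>x i \<le> \<Lambda> i * x i \<le> T 1\<close> for \<open>i \<ge> 1\<close>, which places it
  in a compact product of intervals.\<close>

lemma compact_K: "compact K"
proof -
  have cont: "continuous_on UNIV (\<lambda>x :: nat \<Rightarrow> real. x i)" for i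
    by simp
  have "closed K"
    unfolding K_def
    by (intro closed_Collect_conj closed_Collect_all closed_Collect_imp closed_Collect_le
        closed_Collect_eq open_Collect_const continuous_on_const continuous_on_sum
        continuous_on_mult cont)
  moreover have "K \<subseteq> Pi\<^sub>E UNIV (\<lambda>_. {0..max 0 (T 1)})"
  proof
    fix x assume x: "x \<in> K"
    have "x i \<le> max 0 (T 1)" for i
    proof (cases "i = 0")
      case False
      then have "1 * x i \<le> \<Lambda> i * x i"
        using weight_ge[of i] x by (intro mult_right_mono) (auto simp: K_nonneg)
      then show ?thesis
        using K_weighted_le[OF x, of i] False by simp
    qed (use x in \<open>simp add: K_def\<close>)
    then show "x \<in> Pi\<^sub>E UNIV (\<lambda>_. {0..max 0 (T 1)})"
      using x by (auto simp: PiE_iff K_nonneg)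
  qed
  moreover have "compact (Pi\<^sub>E (UNIV :: nat set) (\<lambda>_. {0..max 0 (T 1)}))"
    by (intro compact_PiE_UNIV) simp
  ultimately show ?thesis
    by (metis compact_Int_closed inf.absorb_iff2)
qed

end

section \<open>The breakage system\<close>

locale nonlinear_breakage =
  fixes \<Lambda> :: "nat \<Rightarrow> real" and \<Gamma> :: "nat \<Rightarrow> nat \<Rightarrow> real"
    and \<phi> :: "nat \<Rightarrow> nat \<Rightarrow> nat \<Rightarrow> real" and \<alpha> :: real and \<psi>\<^sub>0 :: "nat \<Rightarrow> real"
  assumes \<Lambda>_1: "\<Lambda> 1 \<ge> 1"
    and \<Lambda>_mono: "mono_on {1..} (\<lambda>i. \<Lambda> i / real i)"
    and \<Gamma>_nonneg: "i \<ge> 1 \<Longrightarrow> j \<ge> 1 \<Longrightarrow> 0 \<le> \<Gamma> i j"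
    and \<Gamma>_le: "i \<ge> 1 \<Longrightarrow> j \<ge> 1 \<Longrightarrow> \<Gamma> i j \<le> \<Lambda> i * \<Lambda> j"
    and \<phi>_nonneg: "1 \<le> i \<Longrightarrow> i < j \<Longrightarrow> k \<ge> 1 \<Longrightarrow> 0 \<le> \<phi> i j k"
    and \<phi>_mass: "j \<ge> 2 \<Longrightarrow> k \<ge> 1 \<Longrightarrow> (\<Sum>i=1..j-1. real i * \<phi> i j k) = real j"
    and \<phi>_le: "1 \<le> i \<Longrightarrow> i < j \<Longrightarrow> k \<ge> 1 \<Longrightarrow> \<phi> i j k \<le> \<alpha>"
    and \<alpha>_nonneg: "0 \<le> \<alpha>"
    and init_nonneg: "i \<ge> 1 \<Longrightarrow> 0 \<le> \<psi>\<^sub>0 i"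
    and init_moment: "(\<lambda>i. \<Lambda> i * \<psi>\<^sub>0 i) summable_on {1..}"
begin

definition tail :: "nat \<Rightarrow> real" where
  "tail m = (\<Sum>\<^sub>\<infinity>i\<in>{m..}. \<Lambda> i * \<psi>\<^sub>0 i)"

sublocale tail_bound \<Lambda> tail
proof
  show "real i \<le> \<Lambda> i" if "i \<ge> 1" for i
  proof -
    have "1 \<le> \<Lambda> i / real i"
      using mono_onD[OF \<Lambda>_mono, of 1 i] that by (intro order_trans[OF \<Lambda>_1]) simp
    then show ?thesis
      using that by (simp add: le_divide_eq)
  qed
  show "tail \<longlonglongrightarrow> 0"
    unfolding tail_def using init_moment by (rule infsum_atLeast_tendsto_0)
qed

text \<open>Division-free monotonicity of \<open>\<Lambda> i / i\<close>, the form in which the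
  moment inequality takes its weights.\<close>

lemma \<Lambda>_ratio: "\<Lambda> i * real j \<le> \<Lambda> j * real i" if "1 \<le> i" "i \<le> j"
  using mono_onD[OF \<Lambda>_mono, of i j] that by (simp add: field_simps)

section \<open>Gain, loss and mass as weighted series on \<open>K\<close>\<close>

definition inflow :: "nat \<Rightarrow> (nat \<Rightarrow> real) \<Rightarrow> nat \<Rightarrow> real" where
  "inflow i x j = (\<Sum>\<^sub>\<infinity>k\<in>{1..}. (\<phi> i j k * \<Gamma> j k) * x k)"

definition collisions :: "nat \<Rightarrow> (nat \<Rightarrow> real) \<Rightarrow> real" where
  "collisions i x = (\<Sum>\<^sub>\<infinity>j\<in>{1..}. \<Gamma> i j * x j)"

text \<open>Puts the double series into the shape \<open>weight * x j\<close>, where the weight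
  \<open>inflow\<close> is itself such a series in \<open>k\<close>.\<close>

lemma gain_eq: "gain \<phi> \<Gamma> x i = (\<Sum>\<^sub>\<infinity>j\<in>{i+1..}. inflow i x j * x j)"
  unfolding gain_def inflow_def infsum_cmult_left'[symmetric]
  by (intro infsum_cong) (simp add: mult_ac)

lemma loss_eq: "loss \<Gamma> x i = (1 - of_bool (i = 1)) * (collisions i x * x i)"
  unfolding loss_def collisions_def infsum_cmult_left'[symmetric]
  by (simp add: mult_ac)

lemma kernel_abs_le:
  assumes "1 \<le> i" "j \<ge> i + 1" "k \<ge> 1"
  shows "\<bar>\<phi> i j k * \<Gamma> j k\<bar> \<le> (\<alpha> * \<Lambda> j) * \<Lambda> k"
proof -
  have "\<phi> i j k * \<Gamma> j k \<le> \<alpha> * (\<Lambda> j * \<Lambda> k)"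
    using assms by (intro mult_mono \<phi>_le \<Gamma>_le \<alpha>_nonneg \<Gamma>_nonneg) auto
  then show ?thesis
    using assms by (simp add: \<phi>_nonneg \<Gamma>_nonneg mult.assoc)
qed

lemma \<Gamma>_abs_le: "i \<ge> 1 \<Longrightarrow> j \<ge> 1 \<Longrightarrow> \<bar>\<Gamma> i j\<bar> \<le> \<Lambda> i * \<Lambda> j"
  by (simp add: \<Gamma>_nonneg \<Gamma>_le)

lemma inflow_abs_le:
  assumes "x \<in> K" "1 \<le> i" "j \<ge> i + 1"
  shows "\<bar>inflow i x j\<bar> \<le> (\<alpha> * tail 1) * \<Lambda> j"
proof -
  have "\<bar>inflow i x j\<bar> \<le> (\<alpha> * \<Lambda> j) * tail 1"
    unfolding inflow_def using assms
    by (intro weighted_infsum_le kernel_abs_le mult_nonneg_nonneg \<alpha>_nonneg weight_nonneg) auto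
  then show ?thesis
    by (simp add: mult_ac)
qed

lemma collisions_abs_le: "x \<in> K \<Longrightarrow> i \<ge> 1 \<Longrightarrow> \<bar>collisions i x\<bar> \<le> \<Lambda> i * tail 1"
  unfolding collisions_def by (intro weighted_infsum_le \<Gamma>_abs_le weight_nonneg) auto

lemma gain_converges_K:
  assumes "x \<in> K" "1 \<le> i"
  shows "gain_converges \<phi> \<Gamma> x i"
  unfolding gain_converges_def
proof (intro conjI allI impI)
  have swap: "(\<lambda>k. \<phi> i j k * \<Gamma> j k * x j * x k) = (\<lambda>k. (\<phi> i j k * \<Gamma> j k) * x k * x j)" for j
    by (simp add: mult_ac)
  show "(\<lambda>k. \<phi> i j k * \<Gamma> j k * x j * x k) summable_on {1..}" if "j \<ge> i + 1" for j
    unfolding swap using assms that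
    by (intro summable_on_cmult_left weighted_summable[where c = "\<alpha> * \<Lambda> j"] kernel_abs_le
        mult_nonneg_nonneg \<alpha>_nonneg weight_nonneg) auto
  have "(\<lambda>j. inflow i x j * x j) summable_on {i+1..}"
    using assms by (intro weighted_summable[where c = "\<alpha> * tail 1"] inflow_abs_le
        mult_nonneg_nonneg \<alpha>_nonneg K_tail_nonneg) auto
  then show "(\<lambda>j. \<Sum>\<^sub>\<infinity>k\<in>{1..}. \<phi> i j k * \<Gamma> j k * x j * x k) summable_on {i+1..}"
    by (simp only: swap infsum_cmult_left' inflow_def)
qed

lemma loss_converges_K:
  assumes "x \<in> K" "1 \<le> i"
  shows "loss_converges \<Gamma> x i"
proof -
  have "(\<lambda>j. \<Gamma> i j * x i * x j) = (\<lambda>j. \<Gamma> i j * x j * x i)"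
    by (simp add: mult_ac)
  then show ?thesis
    unfolding loss_converges_def using assms
    by (auto intro!: summable_on_cmult_left weighted_summable[where c = "\<Lambda> i"] \<Gamma>_abs_le weight_nonneg)
qed

lemma continuous_on_coordinate: "continuous_on K (\<lambda>x. x i)"
  by (rule continuous_on_subset[OF continuous_on_product_coordinates]) simp

text \<open>\<open>continuous_on_weighted_infsum\<close> is applied twice: to the inner series with
  \<open>c = \<alpha> * \<Lambda> j\<close>, then to the outer one, whose weight is that inner
  series, with \<open>c = \<alpha> * tail 1\<close>.\<close>

lemma continuous_on_gain:
  assumes i: "1 \<le> i"
  shows "continuous_on K (\<lambda>x. gain \<phi> \<Gamma> x i)"
proof (cases "K = {}")
  case False
  then have "0 \<le> tail 1"
    using K_tail_nonneg by blast
  moreover have "continuous_on K (\<lambda>x. inflow i x j)" if "j \<ge> i + 1" for j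
    unfolding inflow_def using i that
    by (intro continuous_on_weighted_infsum[where c = "\<alpha> * \<Lambda> j"] kernel_abs_le
        mult_nonneg_nonneg \<alpha>_nonneg weight_nonneg) auto
  ultimately show ?thesis
    unfolding gain_eq using i
    by (intro continuous_on_weighted_infsum[where c = "\<alpha> * tail 1"] inflow_abs_le
        mult_nonneg_nonneg \<alpha>_nonneg) auto
qed simp

lemma continuous_on_loss: "1 \<le> i \<Longrightarrow> continuous_on K (\<lambda>x. loss \<Gamma> x i)"
  unfolding loss_eq collisions_def
  by (intro continuous_on_mult continuous_on_const continuous_on_coordinate
      continuous_on_weighted_infsum[where c = "\<Lambda> i"] \<Gamma>_abs_le weight_nonneg) auto

definition mass :: "(nat \<Rightarrow> real) \<Rightarrow> real" where
  "mass x = (\<Sum>\<^sub>\<infinity>i\<in>{1..}. real i * x i)"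

lemma continuous_on_mass: "continuous_on K mass"
proof -
  have "continuous_on K (\<lambda>x. \<Sum>\<^sub>\<infinity>i\<in>{1..}. real i * x i)"
    by (rule continuous_on_weighted_infsum[where c = 1]) (use weight_ge in auto)
  then show ?thesis
    by (simp add: mass_def[abs_def])
qed

text \<open>Index \<open>0\<close> carries no physical meaning; setting the rate to \<open>0\<close> there keeps \<open>x 0 = 0\<close>.\<close>

definition rate :: "nat \<Rightarrow> (nat \<Rightarrow> real) \<Rightarrow> real" where
  "rate i x = (if i = 0 then 0 else gain \<phi> \<Gamma> x i - loss \<Gamma> x i)"

lemma continuous_on_rate: "continuous_on K (rate i)"
  unfolding rate_def[abs_def]
  by (cases "i = 0") (auto intro!: continuous_on_diff continuous_on_gain continuous_on_loss)

section \<open>Explicit Euler steps on finitely supported members of \<open>K\<close>\<close>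

context
  fixes N :: nat and x :: "nat \<Rightarrow> real"
  assumes x: "x \<in> K" and supp: "\<And>i. i > N \<Longrightarrow> x i = 0"
begin

lemma infsum_supp: "(\<Sum>\<^sub>\<infinity>j\<in>{p..}. w j * x j) = (\<Sum>j=p..N. w j * x j)"
proof -
  have "(\<Sum>\<^sub>\<infinity>j\<in>{p..}. w j * x j) = (\<Sum>\<^sub>\<infinity>j\<in>{p..N}. w j * x j)"
    by (rule infsum_cong_neutral) (auto simp: supp)
  then show ?thesis
    by simp
qed

text \<open>Breakage only produces smaller clusters: the gain at \<open>i\<close> involves only
  \<open>x j\<close> with \<open>j > i\<close>, so the support never grows.\<close>

lemma rate_supp: "i > N \<Longrightarrow> rate i x = 0"
  by (simp add: rate_def gain_eq loss_eq infsum_supp supp)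

text \<open>Fragments of a cluster of size \<open>j\<close> satisfy
  \<open>U i \<le> (U j / j) * i\<close>, so by \<open>\<phi>_mass\<close> their total weight is at
  most \<open>U j\<close>, which is what the loss removes. No sign is imposed on \<open>U\<close>,
  so decreasing moments with negative weights are covered too.\<close>

lemma moment_rate_le_0:
  assumes U: "\<And>i j. 1 \<le> i \<Longrightarrow> i \<le> j \<Longrightarrow> U i * real j \<le> U j * real i"
  shows "(\<Sum>i=1..N. U i * rate i x) \<le> 0"
proof -
  let ?A = "\<lambda>j k. \<Gamma> j k * x k * x j"
  have A: "0 \<le> ?A j k" if "j \<ge> 1" "k \<ge> 1" for j k
    using that x by (simp add: \<Gamma>_nonneg K_nonneg)
  have "(\<Sum>i=1..N. U i * gain \<phi> \<Gamma> x i)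
      = (\<Sum>i\<in>{1..N}. \<Sum>j | j \<in> {1..N} \<and> i < j. \<Sum>k=1..N. U i * \<phi> i j k * ?A j k)"
  proof (rule sum.cong[OF refl])
    fix i assume "i \<in> {1..N}"
    then have "{i+1..N} = {j. j \<in> {1..N} \<and> i < j}"
      by auto
    moreover have "U i * gain \<phi> \<Gamma> x i = (\<Sum>j=i+1..N. \<Sum>k=1..N. U i * \<phi> i j k * ?A j k)"
      unfolding gain_eq inflow_def infsum_supp
      by (simp add: sum_distrib_left sum_distrib_right mult_ac)
    ultimately show "U i * gain \<phi> \<Gamma> x i
        = (\<Sum>j | j \<in> {1..N} \<and> i < j. \<Sum>k=1..N. U i * \<phi> i j k * ?A j k)"
      by simp
  qed
  \<comment> \<open>Regroups by the parent size \<open>j\<close>, so that all fragments of one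
    parent are compared with its own loss.\<close>
  also have "\<dots> = (\<Sum>j\<in>{1..N}. \<Sum>i | i \<in> {1..N} \<and> i < j. \<Sum>k=1..N. U i * \<phi> i j k * ?A j k)"
    by (rule sum.swap_restrict) auto
  also have "\<dots> \<le> (\<Sum>j=1..N. U j * loss \<Gamma> x j)"
  proof (rule sum_mono)
    fix j assume j: "j \<in> {1..N}"
    show "(\<Sum>i | i \<in> {1..N} \<and> i < j. \<Sum>k=1..N. U i * \<phi> i j k * ?A j k) \<le> U j * loss \<Gamma> x j"
    \<comment> \<open>Monomers have no fragments, and their loss term vanishes as well.\<close>
    proof (cases "j = 1")
      case True
      then have "{i. i \<in> {1..N} \<and> i < j} = {}"
        by auto
      with True show ?thesis
        by (simp only: sum.empty loss_eq) simp
    next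
      case False
      with j have j2: "j \<ge> 2"
        by auto
      have "{i. i \<in> {1..N} \<and> i < j} = {1..j-1}"
        using j by auto
      then have "(\<Sum>i | i \<in> {1..N} \<and> i < j. \<Sum>k=1..N. U i * \<phi> i j k * ?A j k)
          = (\<Sum>k=1..N. (\<Sum>i=1..j-1. U i * \<phi> i j k) * ?A j k)"
        by (simp only: sum_distrib_right) (rule sum.swap)
      also have "\<dots> \<le> (\<Sum>k=1..N. U j * ?A j k)"
      proof (intro sum_mono mult_right_mono)
        fix k assume k: "k \<in> {1..N}"
        have "(\<Sum>i=1..j-1. U i * \<phi> i j k) \<le> (\<Sum>i=1..j-1. U j / real j * (real i * \<phi> i j k))"
        proof (rule sum_mono)
          fix i assume i: "i \<in> {1..j-1}"
          then have "U i \<le> U j / real j * real i"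
            using U[of i j] j2 by (auto simp: field_simps)
          then show "U i * \<phi> i j k \<le> U j / real j * (real i * \<phi> i j k)"
            using mult_right_mono[OF _ \<phi>_nonneg[of i j k], of "U i" "U j / real j * real i"] i k
            by (auto simp: mult.assoc)
        qed
        also have "\<dots> = U j"
          unfolding sum_distrib_left[symmetric] using \<phi>_mass[of j k] j2 k by auto
        finally show "(\<Sum>i=1..j-1. U i * \<phi> i j k) \<le> U j" .
      qed (use A j in auto)
      also have "\<dots> = U j * loss \<Gamma> x j"
        using False by (simp add: loss_eq collisions_def infsum_supp sum_distrib_left sum_distrib_right)
      finally show ?thesis .
    qed
  qed
  finally show ?thesis
    by (simp add: rate_def right_diff_distrib sum_subtractf)
qed

lemma moment_euler_le:
  assumes "\<And>i j. 1 \<le> i \<Longrightarrow> i \<le> j \<Longrightarrow> U i * real j \<le> U j * real i" and "0 \<le> h"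
  shows "(\<Sum>i=1..N. U i * (x i + h * rate i x)) \<le> (\<Sum>i=1..N. U i * x i)"
proof -
  have "(\<Sum>i=1..N. U i * (x i + h * rate i x))
      = (\<Sum>i=1..N. U i * x i) + h * (\<Sum>i=1..N. U i * rate i x)"
    by (simp add: algebra_simps sum.distrib sum_distrib_left)
  then show ?thesis
    using mult_nonneg_nonpos[OF \<open>0 \<le> h\<close> moment_rate_le_0[OF assms(1)]] by simp
qed

text \<open>Only the loss \<open>collisions i x * x i\<close> can lower a coordinate. On
  \<open>K\<close> its factor \<open>collisions i x\<close> is at most
  \<open>\<Lambda> i * tail 1\<close>, so the condition on \<open>h\<close> ensures that at most
  \<open>x i\<close> is removed.\<close>

lemma euler_step_nonneg:
  assumes h: "0 \<le> h" "h * ((\<Sum>i=1..N. \<Lambda> i) * tail 1) \<le> 1"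
  shows "0 \<le> x i + h * rate i x"
proof (cases "i \<in> {1..N}")
  case True
  have "0 \<le> gain \<phi> \<Gamma> x i"
    unfolding gain_eq inflow_def using True x
    by (intro infsum_nonneg mult_nonneg_nonneg) (auto simp: \<phi>_nonneg \<Gamma>_nonneg K_nonneg)
  then have "0 \<le> h * gain \<phi> \<Gamma> x i"
    using h by simp
  moreover have "h * loss \<Gamma> x i \<le> x i"
  proof -
    have "collisions i x \<le> \<Lambda> i * tail 1"
      using collisions_abs_le[OF x, of i] True by simp
    also have "\<dots> \<le> (\<Sum>i=1..N. \<Lambda> i) * tail 1"
      using True K_tail_nonneg[OF x]
      by (intro mult_right_mono member_le_sum) (auto intro: weight_nonneg)
    finally have "h * collisions i x \<le> 1"
      using h(2) mult_left_mono[OF _ h(1)] order_trans by blast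
    then have "h * collisions i x * x i \<le> 1 * x i"
      using K_nonneg[OF x] by (intro mult_right_mono)
    then show ?thesis
      by (simp add: loss_eq mult.assoc K_nonneg[OF x])
  qed
  ultimately show ?thesis
    using True by (simp add: rate_def right_diff_distrib)
next
  case False
  then show ?thesis
    using K_nonneg[OF x, of i] rate_supp[of i] by (cases "i = 0") (auto simp: rate_def)
qed

lemma euler_step_K:
  assumes h: "0 \<le> h" "h * ((\<Sum>i=1..N. \<Lambda> i) * tail 1) \<le> 1"
  shows "(\<lambda>i. x i + h * rate i x) \<in> K"
proof -
  let ?y = "\<lambda>i. x i + h * rate i x"
  have "(\<Sum>i=m..n. \<Lambda> i * ?y i) \<le> tail m" if m: "m \<ge> 1" for m n
  proof -
    \<comment> \<open>Cutting \<open>\<Lambda>\<close> off below \<open>m\<close> keeps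
      \<open>U i / i\<close> non-decreasing, so the moment inequality controls the tail from
      \<open>m\<close> on.\<close>
    let ?U = "\<lambda>i. if m \<le> i then \<Lambda> i else 0"
    \<comment> \<open>As \<open>n\<close> may be smaller than \<open>N\<close>, the sum is first
      enlarged by non-negative terms to cover the support and then cut back to
      \<open>N\<close>.\<close>
    have "(\<Sum>i=m..n. \<Lambda> i * ?y i) \<le> (\<Sum>i=m..max n N. \<Lambda> i * ?y i)"
      using m euler_step_nonneg[OF h]
      by (intro sum_mono2) (auto intro!: mult_nonneg_nonneg weight_nonneg)
    also have "\<dots> = (\<Sum>i=m..N. \<Lambda> i * ?y i)"
      by (intro sum.mono_neutral_right) (auto simp: supp rate_supp)
    also have "\<dots> = (\<Sum>i=1..N. ?U i * ?y i)"
      using m by (intro sum.mono_neutral_cong_left) auto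
    also have "\<dots> \<le> (\<Sum>i=1..N. ?U i * x i)"
      by (intro moment_euler_le h(1)) (auto simp: \<Lambda>_ratio weight_nonneg)
    also have "\<dots> = (\<Sum>i=m..N. \<Lambda> i * x i)"
      using m by (intro sum.mono_neutral_cong_right) auto
    also have "\<dots> \<le> tail m"
      by (rule K_sum_le[OF x m])
    finally show ?thesis .
  qed
  then show ?thesis
    using x euler_step_nonneg[OF h] by (auto simp: K_def rate_def)
qed

lemma mass_euler_step: "(\<Sum>i=1..N. real i * (x i + h * rate i x)) = (\<Sum>i=1..N. real i * x i)"
proof -
  \<comment> \<open>For \<open>U i = i\<close> the ratio condition holds with equality, so the
    moment inequality applies to both \<open>U\<close> and \<open>-U\<close>.\<close>
  have "(\<Sum>i=1..N. real i * rate i x) = 0"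
    using moment_rate_le_0[of real] moment_rate_le_0[of "\<lambda>i. - real i"] by (simp add: sum_negf)
  then show ?thesis
    by (simp add: distrib_left mult.left_commute[of _ h] sum.distrib sum_distrib_left[symmetric])
qed

end

section \<open>Euler approximations from truncated initial data and their limit\<close>

definition truncated :: "nat \<Rightarrow> nat \<Rightarrow> real" where
  "truncated n i = (if i \<in> {1..n} then \<psi>\<^sub>0 i else 0)"

lemma truncated_K: "truncated n \<in> K"
proof -
  have "(\<Sum>i=m..l. \<Lambda> i * truncated n i) \<le> tail m" if m: "m \<ge> 1" for m l
  proof -
    have "(\<Sum>i=m..l. \<Lambda> i * truncated n i) \<le> (\<Sum>i=m..l. \<Lambda> i * \<psi>\<^sub>0 i)"
      using m by (intro sum_mono mult_left_mono) (auto simp: truncated_def init_nonneg weight_nonneg)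
    also have "\<dots> \<le> tail m"
      unfolding tail_def using m summable_on_subset[OF init_moment, of "{m..}"]
      by (intro finite_sum_le_infsum) (auto simp: init_nonneg weight_nonneg)
    finally show ?thesis .
  qed
  then show ?thesis
    by (auto simp: K_def truncated_def init_nonneg)
qed

text \<open>The first summand of the denominator enforces the step condition of
  \<open>euler_step_K\<close>; the second keeps the denominator positive and drives the step size to
  0.\<close>

definition stepsize :: "nat \<Rightarrow> real" where
  "stepsize n = 1 / ((\<Sum>i=1..n. \<Lambda> i) * tail 1 + real (Suc n))"

text \<open>The index \<open>n\<close> governs truncation and step size together, while
  \<open>m\<close> counts time steps.\<close>

definition euler :: "nat \<Rightarrow> nat \<Rightarrow> nat \<Rightarrow> real" where
  "euler n m = ((\<lambda>x i. x i + stepsize n * rate i x) ^^ m) (truncated n)"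

lemma moment_bound_nonneg: "0 \<le> (\<Sum>i=1..n. \<Lambda> i) * tail 1"
  using K_tail_nonneg[OF truncated_K[of 0]]
  by (intro mult_nonneg_nonneg sum_nonneg) (auto simp: weight_nonneg)

lemma stepsize_pos: "0 < stepsize n"
  unfolding stepsize_def using moment_bound_nonneg[of n] by (intro divide_pos_pos) auto

lemma stepsize_bound: "stepsize n * ((\<Sum>i=1..n. \<Lambda> i) * tail 1) \<le> 1"
  unfolding stepsize_def using moment_bound_nonneg[of n] by (simp add: divide_le_eq)

lemma stepsize_null: "stepsize \<longlonglongrightarrow> 0"
proof (rule tendsto_sandwich[OF _ _ tendsto_const LIMSEQ_inverse_real_of_nat])
  show "\<forall>\<^sub>F n in sequentially. stepsize n \<le> inverse (real (Suc n))"
    unfolding stepsize_def inverse_eq_divide using moment_bound_nonneg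
    by (intro always_eventually allI divide_left_mono mult_pos_pos add_nonneg_pos) auto
qed (simp add: less_imp_le[OF stepsize_pos])

lemma euler_K: "euler n m \<in> K" and euler_supp: "i > n \<Longrightarrow> euler n m i = 0"
proof -
  have "euler n m \<in> K \<and> (\<forall>i>n. euler n m i = 0)"
  proof (induction m)
    case 0
    show ?case
      by (simp add: euler_def truncated_K) (simp add: truncated_def)
  next
    case (Suc m)
    then show ?case
      using euler_step_K[of "euler n m" n "stepsize n"] rate_supp[of "euler n m" n]
        stepsize_pos[of n] stepsize_bound[of n]
      by (auto simp: euler_def)
  qed
  then show "euler n m \<in> K" "i > n \<Longrightarrow> euler n m i = 0"
    by auto
qed

lemma mass_euler: "mass (euler n m) = mass (euler n 0)"
proof (induction m)
  case (Suc m)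
  have "mass (euler n (Suc m)) = (\<Sum>i=1..n. real i * euler n (Suc m) i)"
    unfolding mass_def using infsum_supp[OF euler_K euler_supp] .
  also have "\<dots> = (\<Sum>i=1..n. real i * euler n m i)"
    using mass_euler_step[of "euler n m" n "stepsize n"] euler_K euler_supp
    by (simp add: euler_def)
  also have "\<dots> = mass (euler n m)"
    unfolding mass_def using infsum_supp[OF euler_K euler_supp] by metis
  finally show ?case
    using Suc by simp
qed simp

text \<open>Each coordinate is eventually constant. The limit is 0 at index 0, as membership in
  \<open>K\<close> demands, whatever \<open>\<psi>\<^sub>0 0\<close> is.\<close>

lemma truncated_tendsto: "truncated \<longlonglongrightarrow> (\<lambda>i. if i \<ge> 1 then \<psi>\<^sub>0 i else 0)"
  unfolding tendsto_fun_iff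
proof
  fix i
  have "\<forall>\<^sub>F n in sequentially. truncated n i = (if i \<ge> 1 then \<psi>\<^sub>0 i else 0)"
    using eventually_ge_at_top[of i] by eventually_elim (auto simp: truncated_def)
  then show "(\<lambda>n. truncated n i) \<longlonglongrightarrow> (if i \<ge> 1 then \<psi>\<^sub>0 i else 0)"
    by (rule tendsto_eventually)
qed

lemma solution_exists:
  obtains f :: "real \<Rightarrow> nat \<Rightarrow> real" where "\<And>t. f t \<in> K" "\<And>i. i \<ge> 1 \<Longrightarrow> f 0 i = \<psi>\<^sub>0 i"
    "\<And>i t. t \<ge> 0 \<Longrightarrow> ((\<lambda>s. f s i) has_real_derivative rate i (f t)) (at t within {0..})"
    "\<And>t. mass (f t) = mass \<psi>\<^sub>0"
proof -
  have "(\<lambda>n. euler n 0) \<longlonglongrightarrow> (\<lambda>i. if i \<ge> 1 then \<psi>\<^sub>0 i else 0)"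
    using truncated_tendsto by (simp add: euler_def)
  then obtain f where f: "\<And>t. f t \<in> K" "f 0 = (\<lambda>i. if i \<ge> 1 then \<psi>\<^sub>0 i else 0)"
    "\<And>i t. t \<ge> 0 \<Longrightarrow> ((\<lambda>s. f s i) has_real_derivative rate i (f t)) (at t within {0..})"
    "\<And>(H :: (nat \<Rightarrow> real) \<Rightarrow> real) t. continuous_on K H \<Longrightarrow>
       (\<And>n m. H (euler n m) = H (euler n 0)) \<Longrightarrow> H (f t) = H (\<lambda>i. if i \<ge> 1 then \<psi>\<^sub>0 i else 0)"
    by (rule euler_limit[where F = rate and X = euler, OF compact_K continuous_on_rate euler_K _
          stepsize_pos stepsize_null, rotated]) (auto simp: euler_def)
  have "mass (\<lambda>i. if i \<ge> 1 then \<psi>\<^sub>0 i else 0) = mass \<psi>\<^sub>0"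
    unfolding mass_def by (intro infsum_cong) auto
  then have "mass (f t) = mass \<psi>\<^sub>0" for t
    using f(4)[OF continuous_on_mass mass_euler] by simp
  with f(1-3) show ?thesis
    by (intro that[of f]) auto
qed

end

section \<open>From the limit curve to a mass-conserving classical solution\<close>

theorem theorem1p5:
  fixes \<Lambda> :: "nat \<Rightarrow> real"
    and \<Gamma> :: "nat \<Rightarrow> nat \<Rightarrow> real"
    and \<phi> :: "nat \<Rightarrow> nat \<Rightarrow> nat \<Rightarrow> real"
    and \<alpha>\<^sub>0 :: real
    and \<psi>_in :: "nat \<Rightarrow> real"
    and G\<^sub>0 :: "real \<Rightarrow> real"
  assumes "\<And>i. i \<ge> 1 \<Longrightarrow> \<Lambda> i \<ge> 0"
    and "\<Lambda> 1 \<ge> 1"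
    and "mono_on {1..} (\<lambda>i. \<Lambda> i / real i)"
    and "\<And>i j. i \<ge> 1 \<Longrightarrow> j \<ge> 1 \<Longrightarrow> 0 \<le> \<Gamma> i j \<and> \<Gamma> i j = \<Gamma> j i \<and> \<Gamma> i j \<le> \<Lambda> i * \<Lambda> j"
    and "\<And>i j k. 1 \<le> i \<Longrightarrow> i < j \<Longrightarrow> k \<ge> 1 \<Longrightarrow> \<phi> i j k \<ge> 0"
    and "\<And>j k. j \<ge> 2 \<Longrightarrow> k \<ge> 1 \<Longrightarrow> (\<Sum>i=1..j-1. real i * \<phi> i j k) = real j"
    and "\<alpha>\<^sub>0 \<ge> 0"
    and "\<And>i j k. 1 \<le> i \<Longrightarrow> i < j \<Longrightarrow> k \<ge> 1 \<Longrightarrow> \<phi> i j k \<le> \<alpha>\<^sub>0"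
    and "\<psi>_in \<in> Y1_plus"
    and "G\<^sub>0 \<in> G1_inf"
    and "(\<lambda>i. G\<^sub>0 (real i) * \<psi>_in i) summable_on {1..}"
    and "M_finite \<Lambda> \<psi>_in"
  shows "\<exists>\<psi>. classical_solution \<phi> \<Gamma> \<psi>_in \<psi> \<and> mass_conserving \<psi>_in \<psi> \<and>
           (\<forall>t\<ge>0. M_finite \<Lambda> (\<lambda>i. \<psi> i t) \<and> M_weight \<Lambda> (\<lambda>i. \<psi> i t) \<le> M_weight \<Lambda> \<psi>_in)"
proof -
  interpret nonlinear_breakage \<Lambda> \<Gamma> \<phi> \<alpha>\<^sub>0 \<psi>_in
    using assms by unfold_locales (auto simp: Y1_plus_def M_finite_def)
  obtain f where fK: "\<And>t. f t \<in> K" and f0: "\<And>i. i \<ge> 1 \<Longrightarrow> f 0 i = \<psi>_in i"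
    and f': "\<And>i t. t \<ge> 0 \<Longrightarrow> ((\<lambda>s. f s i) has_real_derivative rate i (f t)) (at t within {0..})"
    and f_mass: "\<And>t. mass (f t) = mass \<psi>_in"
    using solution_exists by blast
  define \<psi> where "\<psi> i t = f t i" for i t
  have \<psi>_f: "(\<lambda>i. \<psi> i t) = f t" for t
    by (simp add: \<psi>_def)
  have \<psi>': "(\<psi> i has_real_derivative rate i (f t)) (at t within {0..})" if "t \<ge> 0" for i t
    using f'[OF that, of i] by (simp add: \<psi>_def[abs_def])
  have diff: "\<psi> i differentiable_on {0..}" for i
    using \<psi>' unfolding differentiable_on_def
    by (auto intro: differentiableI[OF has_field_derivative_imp_has_derivative])
  have hderiv: "hderiv (\<psi> i) t = rate i (f t)" if "t \<ge> 0" for i t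
    unfolding hderiv_def
  proof (rule vector_derivative_within)
    \<comment> \<open>Every \<open>t \<ge> 0\<close> is a limit point of the half-line, from the
      right even at 0, so the derivative within it is unique.\<close>
    have "at_right t \<le> at t within {0..}"
      using that by (intro at_le) auto
    then show "at t within {0..} \<noteq> bot"
      using trivial_limit_at_right_real[of t] bot.extremum_uniqueI by metis
  qed (use \<psi>'[OF that, of i] in \<open>simp add: has_real_derivative_iff_has_vector_derivative\<close>)
  \<comment> \<open>Differentiable coordinates make the curve continuous in the product topology;
    any functional continuous on \<open>K\<close> is then continuous in time along it.\<close>
  have "continuous_on {0..} f"
    using diff differentiable_imp_continuous_on
    by (intro continuous_on_coordinatewise_then_product) (auto simp: \<psi>_def[abs_def])
  then have cont: "continuous_on {0..} (\<lambda>t. H (f t))"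
    if "continuous_on K H" for H :: "(nat \<Rightarrow> real) \<Rightarrow> real"
    using continuous_on_compose2[OF that] fK by blast
  have norm_mass: "norm_Y1 x = mass x" if "\<And>i. i \<ge> 1 \<Longrightarrow> 0 \<le> x i" for x
    unfolding norm_Y1_def mass_def using that by (intro infsum_cong) auto
  have "f t \<in> Y1_plus" for t
  proof -
    have "(\<lambda>i. real i * f t i) summable_on {1..}"
      using weight_ge by (intro weighted_summable[OF fK, of _ 1]) auto
    then show ?thesis
      by (simp add: Y1_plus_def Y1_def K_nonneg[OF fK])
  qed
  moreover have "C1_halfline (\<psi> i)" for i
  proof -
    have "continuous_on {0..} (hderiv (\<psi> i))"
      using cont[OF continuous_on_rate, of i] by (rule continuous_on_eq) (simp add: hderiv)
    then show ?thesis
      using diff by (simp add: C1_halfline_def)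
  qed
  moreover have "hderiv (\<psi> i) t = gain \<phi> \<Gamma> (f t) i - loss \<Gamma> (f t) i" if "i \<ge> 1" "t \<ge> 0" for i t
    using hderiv that by (simp add: rate_def)
  ultimately have "classical_solution \<phi> \<Gamma> \<psi>_in \<psi>"
    unfolding classical_solution_def \<psi>_f
    using fK f0 cont[OF continuous_on_gain] cont[OF continuous_on_loss]
    by (auto simp: gain_converges_K loss_converges_K \<psi>_def)
  moreover have "mass_conserving \<psi>_in \<psi>"
    unfolding mass_conserving_def \<psi>_f
    using f_mass by (simp add: norm_mass K_nonneg[OF fK] init_nonneg)
  moreover have "M_finite \<Lambda> (f t) \<and> M_weight \<Lambda> (f t) \<le> M_weight \<Lambda> \<psi>_in" for t
  proof -
    have nonneg: "0 \<le> \<Lambda> i * f t i" if "i \<ge> 1" for i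
      using that by (simp add: weight_nonneg K_nonneg[OF fK])
    \<comment> \<open>\<open>tail 1\<close> is the full initial \<open>\<Lambda>\<close>-moment, so
      the case \<open>m = 1\<close> of the tail bounds is the required estimate.\<close>
    have bound: "(\<Sum>i=1..n. \<Lambda> i * f t i) \<le> M_weight \<Lambda> \<psi>_in" for n
      using K_sum_le[OF fK[of t], of 1 n] by (simp add: tail_def M_weight_def)
    show ?thesis
      unfolding M_finite_def M_weight_def[of \<Lambda> "f t"]
      using summable_on_atLeast_nonneg[OF nonneg bound] by blast
  qed
  ultimately show ?thesis
    by (intro exI[of _ \<psi>]) (simp add: \<psi>_f)
qed

end
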